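(* Let $A\in\mathbb{C}_{n,n}$ with $\mathrm{Ind}(A)=k$. Then $A$ can be written as a sum $A=A_1+A_2$ of matrices $A_1,A_2\in\mathbb{C}_{n,n}$ such that (i) $A_1\in\mathbb{C}_n^{\mathtt{CM}}$, i.e. $\mathrm{rk}(A_1^2)=\mathrm{rk}(A_1)$; (ii) $A_2^k=0$ (to be read as $A_2=0$ when $k=0$); (iii) $A_1^\ast A_2=A_2A_1=0$. Here one or both of $A_1$ and $A_2$ can be null.
   Context: $\mathbb{C}_{n,n}$ is the set of $n\times n$ complex matrices, $A^\ast$ is the conjugate transpose, $\mathrm{rk}$ is the rank. The index $\mathrm{Ind}(A)$ of $A\in\mathbb{C}_{n,n}$ is $0$ if $A$ is non-singular, and otherwise is the smallest positive integer $k$ with $\mathrm{rk}(A^{k+1})=\mathrm{rk}(A^k)$ (so the index of the null matrix is $1$). $\mathbb{C}_n^{\mathtt{CM}}=\{A\in\mathbb{C}_{n,n} : \mathrm{rk}(A^2)=\mathrm{rk}(A)\}$ is the set of core-invertible (equivalently, group-invertible) matrices. *)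

theory Defs
  imports
    "Jordan_Normal_Form.DL_Rank"
    "Jordan_Normal_Form.Schur_Decomposition"
begin

abbreviation mat_rank :: "nat \<Rightarrow> complex mat \<Rightarrow> nat" where
  "mat_rank n A \<equiv> vec_space.rank n A"

(* For square A the LEAST is always attained, since the ranks of the powers
   A, A^2, ... form a non-increasing sequence of natural numbers. *)
definition mat_index :: "nat \<Rightarrow> complex mat \<Rightarrow> nat" where
  "mat_index n A =
     (if invertible_mat A then 0
      else (LEAST k. 0 < k \<and> mat_rank n (A ^\<^sub>m (k + 1)) = mat_rank n (A ^\<^sub>m k)))"

definition core_invertible_mats :: "nat \<Rightarrow> complex mat set" where
  "core_invertible_mats n = {A \<in> carrier_mat n n. mat_rank n (A ^\<^sub>m 2) = mat_rank n A}"

end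

theory Submission
  imports Defs
begin

text \<open>Let \<open>P\<close> be the orthogonal projector onto the range of \<open>A ^\<^sub>m k\<close> and put \<open>A1 = P * A\<close>,
  \<open>A2 = (1 - P) * A\<close> (the core-EP decomposition). The range of \<open>A ^\<^sub>m k\<close> is invariant under \<open>A\<close>,
  so \<open>(1 - P) * A * P = 0\<close>; this gives \<open>A2 * A1 = 0\<close> and \<open>A2 ^\<^sub>m j = (1 - P) * A ^\<^sub>m j\<close> for \<open>j > 0\<close>,
  which vanishes at \<open>j = k\<close>. On that range \<open>A1\<close> acts as \<open>A\<close>, and the index condition provides \<open>X\<close>
  with \<open>A ^\<^sub>m k = A ^\<^sub>m (k + 1) * X\<close>; hence \<open>A1 = A1 * A1 * Z\<close> for some \<open>Z\<close>, and
  the two ranks agree.\<close>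

section \<open>Column spaces, rank and factorization\<close>

context vec_space
begin

text \<open>A basis of \<open>X\<close> stays linearly independent in \<open>W\<close>, because
  independence and span inside either subspace agree with those in \<open>V\<close>. It has at least
  as many elements as the dimension of \<open>W\<close>, so it spans \<open>W\<close> too.\<close>

lemma subspace_eq_if_dim_eq:
  assumes X: "VectorSpace.subspace class_ring X V" and W: "VectorSpace.subspace class_ring W V"
    and XW: "X \<subseteq> W"
    and fX: "vectorspace.fin_dim class_ring (vs X)"
    and fW: "vectorspace.fin_dim class_ring (vs W)"
    and dim: "vectorspace.dim class_ring (vs W) \<le> vectorspace.dim class_ring (vs X)"
  shows "X = W"
proof -
  interpret VX: vectorspace class_ring "vs X" by (rule subspace_is_vs[OF X])
  interpret VW: vectorspace class_ring "vs W" by (rule subspace_is_vs[OF W])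
  obtain b where fb: "finite b" and b: "VX.basis b"
    using VX.finite_basis_exists[OF fX] by blast
  have bX: "b \<subseteq> X" and liX: "VX.lin_indpt b" and spX: "VX.span b = X"
    using b unfolding VX.basis_def by auto
  have smX: "submodule class_ring X V" and smW: "submodule class_ring W V"
    using X W by (auto simp: VectorSpace.subspace_def)
  have bW: "b \<subseteq> W" using bX XW by blast
  have liW: "VW.lin_indpt b"
    using liX span_li_not_depend(2)[OF bX smX] span_li_not_depend(2)[OF bW smW] by simp
  have "card b \<ge> VW.dim" using dim VX.dim_basis[OF fb b] by simp
  then have "VW.basis b" using VW.dim_li_is_basis[OF fW fb _ liW] bW by simp
  then have "VW.span b = W" unfolding VW.basis_def by simp
  then show ?thesis
    using spX span_li_not_depend(1)[OF bX smX] span_li_not_depend(1)[OF bW smW] by simp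
qed

lemma col_space_subspace:
  assumes "A \<in> carrier_mat n nc"
  shows "VectorSpace.subspace class_ring (col_space A) V"
  unfolding col_space_def using assms cols_dim span_is_subspace by blast

lemma fin_dim_col_space:
  assumes "A \<in> carrier_mat n nc"
  shows "vectorspace.fin_dim class_ring (vs (col_space A))"
  unfolding col_space_def using fin_dim_span_cols[OF assms] .

lemma rank_eq_dim_col_space: "rank A = vectorspace.dim class_ring (vs (col_space A))"
  unfolding rank_def col_space_def ..

lemma col_space_mult_subset:
  assumes A: "A \<in> carrier_mat n nc" and B: "B \<in> carrier_mat nc m"
  shows "col_space (A * B) \<subseteq> col_space A"
proof
  fix y assume "y \<in> col_space (A * B)"
  then obtain x where x: "x \<in> carrier_vec m" and y: "y \<in> carrier_vec n" "A * B *\<^sub>v x = y"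
    using col_space_eq[OF mult_carrier_mat[OF A B]] A B by auto
  have "A *\<^sub>v (B *\<^sub>v x) = y" using y(2) assoc_mult_mat_vec[OF A B x] by simp
  moreover have "B *\<^sub>v x \<in> carrier_vec nc" using B x by simp
  ultimately show "y \<in> col_space A" using col_space_eq[OF A] A y(1) by auto
qed

lemma rank_mult_le:
  assumes A: "A \<in> carrier_mat n nc" and B: "B \<in> carrier_mat nc m"
  shows "rank (A * B) \<le> rank A"
proof -
  have AB: "A * B \<in> carrier_mat n m" using A B by simp
  have "VectorSpace.subspace class_ring (col_space (A * B)) (vs (col_space A))"
    by (intro nested_subspaces col_space_subspace[OF A] col_space_subspace[OF AB]
        col_space_mult_subset[OF A B])
  from vectorspace.subspace_dim[OF subspace_is_vs[OF col_space_subspace[OF A]] this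
      fin_dim_col_space[OF A]] fin_dim_col_space[OF AB]
  show ?thesis unfolding rank_eq_dim_col_space by simp
qed

text \<open>Each column of \<open>C\<close> is \<open>A\<close> applied to some vector; such
  preimages, chosen column by column, are the columns of \<open>X\<close>.\<close>

lemma factor_if_col_space_subset:
  assumes A: "A \<in> carrier_mat n nc" and C: "C \<in> carrier_mat n m"
    and sub: "col_space C \<subseteq> col_space A"
  obtains X where "X \<in> carrier_mat nc m" "C = A * X"
proof -
  have "\<exists>x \<in> carrier_vec nc. A *\<^sub>v x = col C j" if j: "j < m" for j
  proof -
    have "col C j \<in> set (cols C)" using j C by (auto simp: cols_def)
    then have "col C j \<in> col_space C"
      unfolding col_space_def using span_mem[of "set (cols C)"] C cols_dim[of C] by simp
    then show ?thesis using sub col_space_eq[OF A] A by auto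
  qed
  then obtain f where f: "\<And>j. j < m \<Longrightarrow> f j \<in> carrier_vec nc \<and> A *\<^sub>v f j = col C j"
    by metis
  define X where "X = mat_of_cols nc (map f [0..<m])"
  have X: "X \<in> carrier_mat nc m" unfolding X_def by auto
  have "C = A * X"
  proof (rule mat_col_eqI)
    fix j assume "j < dim_col (A * X)"
    then have j: "j < m" using X by simp
    have "col X j = f j" unfolding X_def using f[OF j] j by simp
    then show "col C j = col (A * X) j" using col_mult2[OF A X j] f[OF j] by simp
  qed (use A X C in auto)
  with X show ?thesis by (rule that)
qed

text \<open>Equal ranks turn the inclusion of \<open>col_space (A * B)\<close> in
  \<open>col_space A\<close> into an equality. This converts the rank condition in the index into a
  matrix equation.\<close>

lemma factor_if_rank_mult_eq:
  assumes A: "A \<in> carrier_mat n nc" and B: "B \<in> carrier_mat nc m"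
    and rk: "rank (A * B) = rank A"
  obtains X where "X \<in> carrier_mat m nc" "A = A * B * X"
proof -
  have AB: "A * B \<in> carrier_mat n m" using A B by simp
  have "col_space (A * B) = col_space A"
    using rk unfolding rank_eq_dim_col_space
    by (intro subspace_eq_if_dim_eq col_space_subspace[OF A] col_space_subspace[OF AB]
        col_space_mult_subset[OF A B] fin_dim_col_space[OF A] fin_dim_col_space[OF AB]) simp
  then show ?thesis using factor_if_col_space_subset[OF AB A] that by blast
qed

end

section \<open>Matrix subtraction and the adjoint\<close>

lemma minus_add_cancel_mat:
  fixes A B :: "'a :: group_add mat"
  assumes "A \<in> carrier_mat n m" "B \<in> carrier_mat n m"
  shows "A - B + B = A"
  using assms by (intro eq_matI) auto

lemma mat_adjoint_dim [simp]:
  "dim_row (mat_adjoint A) = dim_col A" "dim_col (mat_adjoint A) = dim_row A"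
  unfolding mat_adjoint_def by auto

lemma mat_adjoint_carrier [simp]:
  "A \<in> carrier_mat n m \<Longrightarrow> mat_adjoint A \<in> carrier_mat m n"
  by (intro carrier_matI) auto

lemma mat_adjoint_index [simp]:
  "i < dim_col A \<Longrightarrow> j < dim_row A \<Longrightarrow> mat_adjoint A $$ (i, j) = conjugate (A $$ (j, i))"
  unfolding mat_adjoint_def by (simp add: mat_of_rows_index)

lemma mat_adjoint_adjoint [simp]: "mat_adjoint (mat_adjoint A) = A"
  by (intro eq_matI) auto

lemma mat_adjoint_add:
  assumes "A \<in> carrier_mat n m" "B \<in> carrier_mat n m"
  shows "mat_adjoint (A + B) = mat_adjoint A + mat_adjoint B"
  using assms by (intro eq_matI) (auto simp: conjugate_dist_add)

lemma mat_adjoint_mult: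
  fixes A B :: "complex mat"
  assumes "A \<in> carrier_mat n m" "B \<in> carrier_mat m l"
  shows "mat_adjoint (A * B) = mat_adjoint B * mat_adjoint A"
  using assms by (intro eq_matI) (auto simp: scalar_prod_def mult.commute intro!: sum.cong)

section \<open>Orthogonal projectors by Gram-Schmidt\<close>

lemma mat_adjoint_mult_self_col:
  fixes W :: "complex mat"
  assumes W: "W \<in> carrier_mat n 1" and W0: "W \<noteq> 0\<^sub>m n 1"
  obtains d where "d \<in> carrier_mat 1 1" "mat_adjoint d = d" "mat_adjoint W * W * d = 1\<^sub>m 1"
proof -
  \<comment> \<open>\<open>c\<close> is the squared norm of \<open>W\<close>, the only entry of
    \<open>mat_adjoint W * W\<close>. It is positive as \<open>W\<close> is nonzero, and its
    reciprocal is real, so \<open>d\<close> is self-adjoint.\<close>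
  define c where "c = (\<Sum>i<n. (cmod (W $$ (i, 0)))\<^sup>2)"
  have "\<exists>i<n. W $$ (i, 0) \<noteq> 0"
  proof (rule ccontr)
    assume "\<not> ?thesis"
    then have "W = 0\<^sub>m n 1" using W by (intro eq_matI) auto
    with W0 show False ..
  qed
  then obtain i where "i < n" "W $$ (i, 0) \<noteq> 0" by blast
  then have "c > 0" unfolding c_def by (intro sum_pos2[of _ i]) auto
  define d where "d = mat 1 1 (\<lambda>_. complex_of_real (1 / c))"
  have "(mat_adjoint W * W) $$ (0, 0) = complex_of_real c"
    using W by (auto simp: scalar_prod_def c_def complex_norm_square mult.commute
        atLeast0LessThan simp del: of_real_power intro!: sum.cong)
  then have "mat_adjoint W * W * d = 1\<^sub>m 1"
    using W \<open>c > 0\<close> unfolding d_def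
    by (intro eq_matI) (auto simp: scalar_prod_def simp flip: of_real_mult)
  moreover have "mat_adjoint d = d" unfolding d_def by (intro eq_matI) auto
  moreover have "d \<in> carrier_mat 1 1" unfolding d_def by simp
  ultimately show ?thesis using that by blast
qed

text \<open>One Gram--Schmidt step: the component \<open>W\<close> of the column \<open>B * E\<close> orthogonal to the range
  of \<open>P\<close> contributes the rank-one projector \<open>W * d * W\<^sup>*\<close> with \<open>d = (W\<^sup>* W)\<inverse>\<close>.\<close>

lemma orthogonal_projector_extend:
  fixes B :: "complex mat"
  assumes B: "B \<in> carrier_mat n m" and E: "E \<in> carrier_mat m 1"
    and Y: "Y \<in> carrier_mat m n"
    and herm: "mat_adjoint (B * Y) = B * Y" and idem: "B * Y * (B * Y) = B * Y"
  shows "\<exists>Z \<in> carrier_mat m n. mat_adjoint (B * Z) = B * Z \<and> B * Z * (B * Z) = B * Z \<and>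
    B * Z * (B * E) = B * E \<and>
    (\<forall>X \<in> carrier_mat n 1. B * Y * X = X \<longrightarrow> B * Z * X = X)"
proof -
  define P where "P = B * Y"
  \<comment> \<open>Orthogonalization is carried out on coefficients: \<open>B * U\<close> is the
    residual of \<open>B * E\<close> after projection, so the new projector can again be written as
    \<open>B\<close> times a matrix.\<close>
  define U where "U = E - Y * (B * E)"
  define W where "W = B * U"
  note [simp] = assms(1-3)
  note One_nat_def [simp del]
  have P[simp]: "P \<in> carrier_mat n n" unfolding P_def using mult_carrier_mat[of B n m Y n] by simp
  have BE[simp]: "B * E \<in> carrier_mat n 1" using mult_carrier_mat[of B n m E 1] by simp
  have YBE: "Y * (B * E) \<in> carrier_mat m 1" using mult_carrier_mat[of Y m n _ 1] by simp
  have U[simp]: "U \<in> carrier_mat m 1" unfolding U_def using YBE by (simp add: minus_carrier_mat)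
  have W[simp]: "W \<in> carrier_mat n 1" unfolding W_def using mult_carrier_mat[of B n m U 1] by simp
  have PP: "P * P = P" using idem unfolding P_def .
  have Ph: "mat_adjoint P = P" using herm unfolding P_def .
  have W_eq: "W = B * E - P * (B * E)"
    unfolding W_def U_def P_def
    using mult_minus_distrib_mat[of B n m E 1] YBE assoc_mult_mat[of B n m Y n "B * E" 1] by simp
  have PBE: "P * (B * E) \<in> carrier_mat n 1" using mult_carrier_mat[of P n n _ 1] by simp
  have PW: "P * W = 0\<^sub>m n 1"
    unfolding W_eq using mult_minus_distrib_mat[of P n n "B * E" 1 "P * (B * E)"] PBE
      assoc_mult_mat[of P n n P n "B * E" 1] PP by simp
  define W' where "W' = mat_adjoint W"
  have W'[simp]: "W' \<in> carrier_mat 1 n" unfolding W'_def by simp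
  have W'h: "mat_adjoint W' = W" unfolding W'_def by simp
  have W'P: "W' * P = 0\<^sub>m 1 n"
  proof -
    have "W' * P = mat_adjoint (P * W)"
      unfolding W'_def by (subst mat_adjoint_mult[of P n n W 1]) (simp_all add: Ph)
    also have "\<dots> = 0\<^sub>m 1 n" unfolding PW by (intro eq_matI) auto
    finally show ?thesis .
  qed
  have BE_eq: "B * E = W + P * (B * E)"
    unfolding W_eq using minus_add_cancel_mat[OF BE PBE] by simp
  show ?thesis
  \<comment> \<open>If the residual vanishes, the new column is already fixed by \<open>P\<close>
    and \<open>Y\<close> can be kept.\<close>
  proof (cases "W = 0\<^sub>m n 1")
    case True
    then have "P * (B * E) = B * E" using BE_eq PBE by simp
    then show ?thesis using PP Ph Y unfolding P_def by (intro bexI[of _ Y]) auto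
  next
    case False
    then obtain d where d[simp]: "d \<in> carrier_mat 1 1" and dh: "mat_adjoint d = d"
      and inv: "mat_adjoint W * W * d = 1\<^sub>m 1"
      using mat_adjoint_mult_self_col[OF W] by blast
    have W'W[simp]: "W' * W \<in> carrier_mat 1 1" using mult_carrier_mat[of W' 1 n W 1] by simp
    have dW'W: "d * (W' * W) = 1\<^sub>m 1"
      using inv mat_mult_left_right_inverse[OF W'W d] unfolding W'_def by simp
    define Q where "Q = W * (d * W')"
    have dW'[simp]: "d * W' \<in> carrier_mat 1 n" using mult_carrier_mat[of d 1 1 W' n] by simp
    have Q[simp]: "Q \<in> carrier_mat n n" unfolding Q_def using mult_carrier_mat[of W n 1 _ n] by simp
    \<comment> \<open>Since \<open>W = B * U\<close>, this correction of \<open>Y\<close> adds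
      exactly \<open>Q\<close> to the projector.\<close>
    define Z where "Z = Y + U * (d * W')"
    have UdW'[simp]: "U * (d * W') \<in> carrier_mat m n" using mult_carrier_mat[of U m 1 _ n] by simp
    have Z: "Z \<in> carrier_mat m n" unfolding Z_def by simp
    have BZ: "B * Z = P + Q"
      unfolding Z_def P_def Q_def W_def
      using mult_add_distrib_mat[of B n m Y n "U * (d * W')"] assoc_mult_mat[of B n m U 1 "d * W'" n]
      by simp
    have Qh: "mat_adjoint Q = Q"
    proof -
      have "mat_adjoint Q = mat_adjoint (d * W') * mat_adjoint W"
        unfolding Q_def by (subst mat_adjoint_mult[of W n 1 _ n]) simp_all
      also have "mat_adjoint (d * W') = W * d"
        by (subst mat_adjoint_mult[of d 1 1 W' n]) (simp_all add: W'h dh)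
      also have "W * d * mat_adjoint W = Q"
        unfolding Q_def W'_def[symmetric] using assoc_mult_mat[of W n 1 d 1 W' n] by simp
      finally show ?thesis .
    qed
    have QX: "Q * X = W * (d * (W' * X))" if X: "X \<in> carrier_mat n l" for X l
      unfolding Q_def using X assoc_mult_mat[of W n 1 "d * W'" n X l] assoc_mult_mat[of d 1 1 W' n X l]
      by simp
    note [simp] = right_mult_zero_mat[of d 1 1] right_mult_zero_mat[of W n 1] right_mult_one_mat[OF W]
      left_mult_zero_mat[OF BE] left_mult_zero_mat[OF dW']
    have QP: "Q * P = 0\<^sub>m n n" using QX[OF P] W'P by simp
    have PQ: "P * Q = 0\<^sub>m n n"
      unfolding Q_def using assoc_mult_mat[of P n n W 1 "d * W'" n] PW by simp
    have QW: "Q * W = W" using QX[OF W] dW'W by simp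
    have QQ: "Q * Q = Q"
    proof -
      have "Q * Q = Q * W * (d * W')"
        using assoc_mult_mat[of Q n n W 1 "d * W'" n] by (simp add: Q_def)
      then show ?thesis by (simp only: QW) (simp only: Q_def)
    qed
    have "mat_adjoint (P + Q) = P + Q" using mat_adjoint_add[OF P Q] Ph Qh by simp
    moreover have "(P + Q) * (P + Q) = P + Q"
      using add_mult_distrib_mat[of P n n Q "P + Q" n] mult_add_distrib_mat[of _ n n P n Q]
        PP PQ QP QQ by simp
    moreover have "(P + Q) * X = X" if X: "X \<in> carrier_mat n 1" and PX: "P * X = X" for X
    proof -
      \<comment> \<open>A vector fixed by \<open>P\<close> is orthogonal to \<open>W\<close>, so
        \<open>Q\<close> annihilates it.\<close>
      have "W' * X = W' * P * X" using assoc_mult_mat[of W' 1 n P n X 1] X PX by simp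
      also have "\<dots> = 0\<^sub>m 1 1" using W'P X by simp
      finally have "Q * X = 0\<^sub>m n 1" using QX[OF X] by simp
      then show ?thesis using add_mult_distrib_mat[of P n n Q X 1] X PX by simp
    qed
    moreover have "(P + Q) * (B * E) = B * E"
    proof -
      \<comment> \<open>Of the two orthogonal components of \<open>B * E\<close>, \<open>Q\<close>
        keeps the residual and kills the one in the range of \<open>P\<close>.\<close>
      have "Q * (B * E) = Q * (W + P * (B * E))" using BE_eq by simp
      also have "\<dots> = Q * W + Q * (P * (B * E))"
        using mult_add_distrib_mat[of Q n n W 1 "P * (B * E)"] PBE by simp
      also have "Q * (P * (B * E)) = 0\<^sub>m n 1"
        using assoc_mult_mat[of Q n n P n "B * E" 1] QP by simp
      finally have "Q * (B * E) = W" using QW by simp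
      then have "(P + Q) * (B * E) = P * (B * E) + W"
        using add_mult_distrib_mat[of P n n Q "B * E" 1] by simp
      then show ?thesis using BE_eq comm_add_mat[OF PBE W] by simp
    qed
    ultimately show ?thesis
      using Z BZ unfolding P_def[symmetric] by (intro bexI[of _ Z]) auto
  qed
qed

text \<open>Iterating the Gram-Schmidt step over the columns of \<open>B\<close> gives a projector
  fixing all of them. The resulting \<open>Y\<close> is a {1,3}-inverse of \<open>B\<close>, and
  \<open>B * Y\<close> is the orthogonal projector onto the range of \<open>B\<close>.\<close>

lemma orthogonal_projector_exists:
  fixes B :: "complex mat"
  assumes B: "B \<in> carrier_mat n m"
  obtains Y where "Y \<in> carrier_mat m n" "mat_adjoint (B * Y) = B * Y" "B * Y * B = B"
proof -
  \<comment> \<open>Unit vectors as one-column matrices, so that \<open>B * e i\<close> is the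
    \<open>i\<close>-th column of \<open>B\<close>.\<close>
  define e :: "nat \<Rightarrow> complex mat" where "e = (\<lambda>i. mat_of_cols m [unit_vec m i])"
  have e: "e i \<in> carrier_mat m 1" for i unfolding e_def by (auto simp: mat_of_cols_def)
  have Be: "B * e i \<in> carrier_mat n 1" for i using B e[of i] by (rule mult_carrier_mat)
  have "\<exists>Y \<in> carrier_mat m n. mat_adjoint (B * Y) = B * Y \<and> B * Y * (B * Y) = B * Y \<and>
    (\<forall>i<j. B * Y * (B * e i) = B * e i)" for j
  proof (induction j)
    case 0
    have "B * 0\<^sub>m m n = 0\<^sub>m n n" using B by simp
    moreover have "mat_adjoint (0\<^sub>m n n :: complex mat) = 0\<^sub>m n n" by (intro eq_matI) auto
    ultimately show ?case by (intro bexI[of _ "0\<^sub>m m n"]) auto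
  next
    case (Suc j)
    then obtain Y where Y: "Y \<in> carrier_mat m n" "mat_adjoint (B * Y) = B * Y"
      "B * Y * (B * Y) = B * Y" and fixed: "\<And>i. i < j \<Longrightarrow> B * Y * (B * e i) = B * e i"
      by blast
    from orthogonal_projector_extend[OF B e Y(1-3), of j] fixed Be
    show ?case by (metis less_Suc_eq)
  qed
  from this[of m] obtain Y where Y: "Y \<in> carrier_mat m n" "mat_adjoint (B * Y) = B * Y"
    and fixed: "\<And>i. i < m \<Longrightarrow> B * Y * (B * e i) = B * e i" by blast
  have BY: "B * Y \<in> carrier_mat n n" using B Y(1) by simp
  have "B * Y * B = B"
  proof (rule mat_col_eqI)
    fix i assume "i < dim_col B"
    then have i: "i < m" using B by simp
    have col_e: "col (C * e i) 0 = col C i" if C: "C \<in> carrier_mat n m" for C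
    proof -
      have "col (e i) 0 = unit_vec m i" unfolding e_def by simp
      then have "col (C * e i) 0 = C *\<^sub>v unit_vec m i" using col_mult2[OF C e, of 0 i] by simp
      then show ?thesis using C i by (intro eq_vecI) auto
    qed
    have "B * Y * B * e i = B * e i" using fixed[OF i] assoc_mult_mat[OF BY B e] by simp
    then show "col (B * Y * B) i = col B i"
      using col_e[OF B] col_e[of "B * Y * B"] BY B by (metis mult_carrier_mat)
  qed (use B Y in auto)
  with Y that show ?thesis by blast
qed

section \<open>Powers and the index\<close>

lemma pow_mat_Suc_left:
  assumes "A \<in> carrier_mat n n"
  shows "A * A ^\<^sub>m k = A ^\<^sub>m k * A"
proof (induction k)
  case (Suc k)
  then show ?case
    using assms assoc_mult_mat[of A n n "A ^\<^sub>m k" n A n] by simp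
qed (use assms in simp)

text \<open>Ranks of successive powers never increase; without a repetition they would drop by at
  least one forever.\<close>

lemma rank_pow_stabilizes:
  assumes A: "A \<in> carrier_mat n n"
  shows "\<exists>k>0. mat_rank n (A ^\<^sub>m (k + 1)) = mat_rank n (A ^\<^sub>m k)"
proof -
  interpret vec_space "TYPE(complex)" n .
  \<comment> \<open>The shift to \<open>Suc k\<close> makes the exponent found below
    positive.\<close>
  let ?r = "\<lambda>k. mat_rank n (A ^\<^sub>m Suc k)"
  have "?r (Suc k) \<le> ?r k" for k
    using rank_mult_le[OF pow_carrier_mat[OF A] A, of "Suc k"] by simp
  then have dec: "?r (Suc k) < ?r k" if "\<forall>k. ?r (Suc k) \<noteq> ?r k" for k
    using that order.not_eq_order_implies_strict by blast
  have "\<exists>k. ?r (Suc k) = ?r k"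
  proof (rule ccontr)
    assume "\<not> ?thesis"
    then have lt: "?r (Suc k) < ?r k" for k using dec by blast
    have "?r k + k \<le> ?r 0" for k
    proof (induction k)
      case (Suc k)
      then show ?case using lt[of k] by linarith
    qed simp
    from this[of "Suc (?r 0)"] show False by linarith
  qed
  then obtain k where "?r (Suc k) = ?r k" ..
  then show ?thesis by (intro exI[of _ "Suc k"]) simp
qed

text \<open>For invertible \<open>A\<close> the index is 0 and \<open>X\<close> is the inverse.
  Otherwise the least exponent is attained, and equality of the two ranks yields the factor.\<close>

lemma pow_mat_index_factor:
  assumes A: "A \<in> carrier_mat n n" and k: "mat_index n A = k"
  obtains X where "X \<in> carrier_mat n n" "A ^\<^sub>m k = A ^\<^sub>m k * A * X"
proof (cases "invertible_mat A")
  case True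
  then obtain B where "inverts_mat A B" "inverts_mat B A" unfolding invertible_mat_def by blast
  then have AB: "A * B = 1\<^sub>m n" and "B * A = 1\<^sub>m (dim_row B)"
    using A unfolding inverts_mat_def by auto
  \<comment> \<open>The size of \<open>B\<close> is read off from the two products: one gives its
    columns, the other its rows.\<close>
  then have "B \<in> carrier_mat n n"
    using A by (metis carrier_matI carrier_matD(2) index_mult_mat(3) index_one_mat(3))
  moreover have "k = 0" using True k unfolding mat_index_def by simp
  ultimately show ?thesis using that A AB by auto
next
  case False
  interpret vec_space "TYPE(complex)" n .
  have "k = (LEAST k. 0 < k \<and> mat_rank n (A ^\<^sub>m (k + 1)) = mat_rank n (A ^\<^sub>m k))"
    using False k unfolding mat_index_def by simp
  then have "mat_rank n (A ^\<^sub>m (k + 1)) = mat_rank n (A ^\<^sub>m k)"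
    using LeastI_ex[OF rank_pow_stabilizes[OF A]] by simp
  then have "rank (A ^\<^sub>m k * A) = rank (A ^\<^sub>m k)" by simp
  from factor_if_rank_mult_eq[OF pow_carrier_mat[OF A] A this] show ?thesis using that by blast
qed

section \<open>The core-EP decomposition\<close>

theorem theorem2p1:
  fixes A :: "complex mat" and n k :: nat
  assumes "A \<in> carrier_mat n n"
    and "mat_index n A = k"
  shows "\<exists>A1 A2. A1 \<in> carrier_mat n n \<and> A2 \<in> carrier_mat n n \<and> A = A1 + A2 \<and>
           A1 \<in> core_invertible_mats n \<and>
           (if k = 0 then A2 = 0\<^sub>m n n else A2 ^\<^sub>m k = 0\<^sub>m n n) \<and>
           mat_adjoint A1 * A2 = 0\<^sub>m n n \<and>
           A2 * A1 = 0\<^sub>m n n"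
proof -
  interpret vec_space "TYPE(complex)" n .
  note A[simp] = assms(1)
  define B where "B = A ^\<^sub>m k"
  have B[simp]: "B \<in> carrier_mat n n" unfolding B_def by simp
  obtain X where X[simp]: "X \<in> carrier_mat n n" and BX: "B = B * A * X"
    using pow_mat_index_factor[OF assms] unfolding B_def by blast
  obtain Y where Y[simp]: "Y \<in> carrier_mat n n" and herm: "mat_adjoint (B * Y) = B * Y"
    and BYB: "B * Y * B = B"
    using orthogonal_projector_exists[OF B] by blast
  have mc[simp]: "C * D \<in> carrier_mat n n"
    if "C \<in> carrier_mat n n" "D \<in> carrier_mat n n" for C D :: "complex mat"
    using that by simp
  note assoc = assoc_mult_mat[of _ n n _ n _ n]
  note dist = mult_minus_distrib_mat[of _ n n _ n] minus_mult_distrib_mat[of _ n n _ _ n]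
    right_mult_one_mat[of _ n n] left_mult_one_mat[of _ n n]
  note left_mult_zero_mat[of _ n n n, simp] right_mult_zero_mat[of _ n n n, simp]
  have AB: "A * B = B * A" unfolding B_def by (rule pow_mat_Suc_left[OF A])
  define P where "P = B * Y"
  define N where "N = 1\<^sub>m n - P"
  have P[simp]: "P \<in> carrier_mat n n" unfolding P_def by simp
  have N[simp]: "N \<in> carrier_mat n n" unfolding N_def by (simp add: minus_carrier_mat)
  have PB: "P * B = B" using BYB unfolding P_def .
  have PP: "P * P = P"
    using PB assoc[of P B Y] unfolding P_def[symmetric] by (simp add: P_def)
  have PN: "P * N = 0\<^sub>m n n" unfolding N_def by (simp add: dist PP)
  have NB: "N * B = 0\<^sub>m n n" unfolding N_def by (simp add: dist PB)
  \<comment> \<open>Commuting \<open>A\<close> past \<open>B\<close> brings \<open>B\<close> next to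
    \<open>N\<close>, which annihilates it.\<close>
  have "N * A * P = N * (A * B) * Y" unfolding P_def by (simp add: assoc)
  also have "\<dots> = N * B * (A * Y)" unfolding AB by (simp add: assoc)
  finally have "N * A * P = N * B * (A * Y)" .
  then have NAP: "N * A * P = 0\<^sub>m n n" using NB by simp
  define A1 where "A1 = P * A"
  define A2 where "A2 = N * A"
  have A1[simp]: "A1 \<in> carrier_mat n n" and A2[simp]: "A2 \<in> carrier_mat n n"
    unfolding A1_def A2_def by simp_all
  have sum: "A = A1 + A2"
    unfolding A1_def A2_def N_def
    using minus_add_cancel_mat[of A n n "P * A"] comm_add_mat[of "P * A" n n "A - P * A"]
    by (simp add: dist minus_carrier_mat)
  have "A2 * A1 = N * A * P * A" unfolding A1_def A2_def by (simp add: assoc)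
  then have A21: "A2 * A1 = 0\<^sub>m n n" using NAP by simp
  have "mat_adjoint A1 * A2 = mat_adjoint A * (P * N) * A"
    unfolding A1_def A2_def
    by (subst mat_adjoint_mult[of P n n A n]) (simp_all add: assoc herm[folded P_def])
  then have A12: "mat_adjoint A1 * A2 = 0\<^sub>m n n" using PN by simp

  have A1B: "A1 * B = A * B"
  proof -
    have "A1 * B = P * B * A" unfolding A1_def using AB by (simp add: assoc)
    then show ?thesis using PB AB by simp
  qed
  have A1AB: "A1 * (A * B) = A * (A * B)"
  proof -
    have "A1 * (A * B) = A1 * B * A" unfolding AB by (simp add: assoc)
    also have "\<dots> = A * (B * A)" unfolding A1B by (simp add: assoc)
    finally show ?thesis unfolding AB .
  qed
  \<comment> \<open>Using \<open>B = A * B * X\<close> twice puts two factors \<open>A\<close> in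
    front of \<open>B\<close>; both may be replaced by \<open>A1\<close>, as they act on the range
    of \<open>B\<close>.\<close>
  have "B = A1 * A1 * (B * X * X)"
  proof -
    have "B = A * B * X" using BX AB by simp
    also have "\<dots> = A * (A * B * X) * X" using BX AB by simp
    also have "\<dots> = A * (A * B) * (X * X)" by (simp add: assoc)
    also have "A * (A * B) = A1 * (A1 * B)" using A1B A1AB by simp
    finally show ?thesis by (simp add: assoc)
  qed
  \<comment> \<open>\<open>A1 = B * (Y * A)\<close>, so the factorization of \<open>B\<close> passes
    to \<open>A1\<close>.\<close>
  then have "A1 = A1 * A1 * (B * X * X) * (Y * A)"
    using A1_def P_def assoc[of B Y A] by simp
  then have A1_eq: "A1 = A1 * A1 * (B * X * X * (Y * A))" by (simp add: assoc)
  have "rank (A1 * A1) = rank A1"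
  proof (rule antisym)
    show "rank (A1 * A1) \<le> rank A1" by (rule rank_mult_le[of _ n _ n]) simp_all
    have "rank (A1 * A1 * (B * X * X * (Y * A))) \<le> rank (A1 * A1)"
      by (rule rank_mult_le[of _ n _ n]) simp_all
    then show "rank A1 \<le> rank (A1 * A1)" using A1_eq by simp
  qed
  moreover have "A1 ^\<^sub>m 2 = A1 * A1" by (simp add: numeral_2_eq_2)
  ultimately have core: "A1 \<in> core_invertible_mats n" unfolding core_invertible_mats_def by simp

  have "N * A * N = N * A * (1\<^sub>m n - P)" by (simp add: N_def)
  also have "\<dots> = N * A * 1\<^sub>m n - N * A * P" by (rule mult_minus_distrib_mat[of _ n n _ n]) simp_all
  also have "\<dots> = N * A" 
    using NAP minus_add_cancel_mat[of "N * A" n n "0\<^sub>m n n"]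
      right_add_zero_mat[of "N * A - 0\<^sub>m n n" n n]
    by (simp add: dist minus_carrier_mat)
  finally have NAN: "N * A * N = N * A" .
  have pow[simp]: "A ^\<^sub>m j \<in> carrier_mat n n" for j by simp
  have NAjN: "N * A ^\<^sub>m Suc j * N = N * A ^\<^sub>m Suc j" for j
  proof (induction j)
    case (Suc j)
    have "N * A ^\<^sub>m Suc (Suc j) * N = N * A ^\<^sub>m Suc j * (A * N)" by (simp add: assoc)
    \<comment> \<open>The induction hypothesis lets an extra \<open>N\<close> be inserted to the
      right of the power.\<close>
    also have "\<dots> = N * A ^\<^sub>m Suc j * (N * A * N)" using Suc
      by (metis A N assoc mc pow)
    also have "\<dots> = N * A ^\<^sub>m Suc j * N * A" unfolding NAN by (simp add: assoc del: pow_mat.simps)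
    also have "\<dots> = N * A ^\<^sub>m Suc (Suc j)" unfolding Suc by (simp add: assoc)
    finally show ?case .
  qed (use NAN in simp)
  \<comment> \<open>The exponent has to be positive: \<open>A2\<close> to the power 0 is the
    identity, in general not \<open>N\<close>.\<close>
  have A2_pow: "A2 ^\<^sub>m Suc j = N * A ^\<^sub>m Suc j" for j
  proof (induction j)
    case (Suc j)
    have "A2 ^\<^sub>m Suc (Suc j) = N * A ^\<^sub>m Suc j * N * A"
      using Suc unfolding A2_def by (simp add: assoc)
    also have "\<dots> = N * A ^\<^sub>m Suc (Suc j)" unfolding NAjN by (simp add: assoc)
    finally show ?case .
  qed (use A2_def in simp)
  have nil: "if k = 0 then A2 = 0\<^sub>m n n else A2 ^\<^sub>m k = 0\<^sub>m n n"
  proof (cases k)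
    case 0
    \<comment> \<open>For index 0, \<open>B\<close> is the identity, so \<open>N * B = 0\<close>
      already says that \<open>N\<close> vanishes.\<close>
    then have "N = 0\<^sub>m n n" 
      using NB right_mult_one_mat[OF N] carrier_matD(1)[OF A] unfolding B_def by simp
    then show ?thesis using 0 unfolding A2_def by simp
  next
    case (Suc j)
    then show ?thesis using A2_pow[of j] NB unfolding B_def by simp
  qed
  show ?thesis using A1 A2 sum core nil A12 A21 by blast
qed

end
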